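(* Let $G$ be a bipartite graph with bipartition $(X,Y)$ and let $k\ge 1$ be an integer with $k|Y|$ even. Let $W=X$ and define $f,g:V(G)\to\mathbb{Z}$ by $f(v)=2$, $g(v)=0$ for $v\in X$ and $f(v)=g(v)=k$ for $v\in Y$. Suppose $G$ has no partial parity $(g,f)$-factor with respect to $X$, and let $(A,B)$ be a biased barrier of $G$. Then: (i) $B\subseteq Y$; (ii) for every odd component $D$ of $G-(A\cup B)$ and every $v\in V(D)$, $e_G(v,B)\le 1$; (iii) for every even component $D$ of $G-(A\cup B)$ and every $v\in V(D)$, $e_G(v,B)=0$; (iv) for every $Z\subseteq A\cap X$ with $N_G(Z)\cap B=\emptyset$, we have $h(Z)\ge 2|Z|$.
   Context: For a graph $G$, $W\subseteq V(G)$ and $f,g:V(G)\to\mathbb{Z}$ with $g\le f$ and $g(v)\equiv f(v)\pmod 2$ for $v\in W$, a partial parity $(g,f)$-factor with respect to $W$ is a spanning subgraph $F$ with $g(v)\le d_F(v)\le f(v)$ for all $v$ and $d_F(v)\equiv f(v)\pmod 2$ for all $v\in W$. For disjoint $A,B\subseteq V(G)$, $e_G(S,T)$ is the number of edges between disjoint vertex sets $S,T$ (with $e_G(v,T)=e_G(\{v\},T)$ and $e_G(D,B)=e_G(V(D),B)$). A component $D$ of $G-(A\cup B)$ is odd if $\sum_{v\in V(D)}f(v)+e_G(D,B)\equiv 1\pmod 2$ and even otherwise. Define $\delta_G(A,B)=\sum_{v\in A}f(v)-\sum_{v\in B}g(v)+\sum_{v\in B}d_{G-A}(v)-h_W(A,B)$,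 where $h_W(A,B)$ is the number of odd components $D$ of $G-(A\cup B)$ such that $g(v)=f(v)$ for all $v\in V(D)\setminus W$. A barrier is a pair $(A,B)$ of disjoint subsets of $V(G)$ with $\delta_G(A,B)<0$. A biased barrier is a barrier $(A,B)$ such that, among all barriers, $\delta_G(A,B)$ is minimum, subject to this $|B|$ is minimum, and subject to both $|A|$ is maximum. For $Z\subseteq A\cap X$, $h(Z)=|N_G(Z)\cap B|+|\{D: D \text{ an odd component of } G-(A\cup B) \text{ with } e_G(Z,D)\ge 1\}|$. *)

theory Defs
  imports "Graph_Theory.Digraph_Component"
begin

text \<open>
  A finite simple undirected graph is the locale predicate \<open>graph\<close>: a finite, loop-free digraph
  without parallel arcs whose arc relation is symmetric, so that an undirected edge is a pair of
  opposite arcs. Hence \<open>out_degree G v\<close> is the degree of \<open>v\<close>, and the strongly connected components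
  (\<open>pre_digraph.sccs\<close>, maximal induced subgraphs) are the connected components.
\<close>

definition bipartition :: "('a, 'b) pre_digraph \<Rightarrow> 'a set \<Rightarrow> 'a set \<Rightarrow> bool" where
  "bipartition G X Y \<longleftrightarrow> X \<union> Y = verts G \<and> X \<inter> Y = {} \<and>
     (\<forall>e \<in> arcs G. tail G e \<in> X \<and> head G e \<in> Y \<or> tail G e \<in> Y \<and> head G e \<in> X)"

text \<open>For disjoint \<open>S\<close>, \<open>T\<close> exactly one of the two arcs of each \<open>S\<close>-\<open>T\<close> edge is counted.\<close>

definition edges_between :: "('a, 'b) pre_digraph \<Rightarrow> 'a set \<Rightarrow> 'a set \<Rightarrow> nat" where
  "edges_between G S T = card {e \<in> arcs G. tail G e \<in> S \<and> head G e \<in> T}"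

text \<open>
  Vertices of \<open>Z\<close> itself are not removed from the neighbourhood; below it is only intersected with
  sets disjoint from \<open>Z\<close>.
\<close>

definition nbhd :: "('a, 'b) pre_digraph \<Rightarrow> 'a set \<Rightarrow> 'a set" where
  "nbhd G Z = {u \<in> verts G. \<exists>z \<in> Z. z \<rightarrow>\<^bsub>G\<^esub> u}"

text \<open>
  The requirements \<open>g \<le> f\<close> on the vertices and \<open>g \<equiv> f (mod 2)\<close> on \<open>W\<close> are standing assumptions on
  the data, not part of the predicate.
\<close>

definition partial_parity_factor ::
  "('a, 'b) pre_digraph \<Rightarrow> 'a set \<Rightarrow> ('a \<Rightarrow> int) \<Rightarrow> ('a \<Rightarrow> int) \<Rightarrow> ('a, 'b) pre_digraph \<Rightarrow> bool" where
  "partial_parity_factor G W g f F \<longleftrightarrow> graph F \<and> spanning F G \<and>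
     (\<forall>v \<in> verts G. g v \<le> int (out_degree F v) \<and> int (out_degree F v) \<le> f v) \<and>
     (\<forall>v \<in> W. int (out_degree F v) mod 2 = f v mod 2)"

definition components_minus ::
  "('a, 'b) pre_digraph \<Rightarrow> 'a set \<Rightarrow> ('a, 'b) pre_digraph set" where
  "components_minus G S = pre_digraph.sccs (G \<restriction> (verts G - S))"

definition odd_components ::
  "('a, 'b) pre_digraph \<Rightarrow> ('a \<Rightarrow> int) \<Rightarrow> 'a set \<Rightarrow> 'a set \<Rightarrow> ('a, 'b) pre_digraph set" where
  "odd_components G f A B = {D \<in> components_minus G (A \<union> B).
     odd ((\<Sum>v \<in> verts D. f v) + int (edges_between G (verts D) B))}"

definition even_components ::
  "('a, 'b) pre_digraph \<Rightarrow> ('a \<Rightarrow> int) \<Rightarrow> 'a set \<Rightarrow> 'a set \<Rightarrow> ('a, 'b) pre_digraph set" where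
  "even_components G f A B = components_minus G (A \<union> B) - odd_components G f A B"

definition h_W ::
  "('a, 'b) pre_digraph \<Rightarrow> 'a set \<Rightarrow> ('a \<Rightarrow> int) \<Rightarrow> ('a \<Rightarrow> int) \<Rightarrow> 'a set \<Rightarrow> 'a set \<Rightarrow> nat" where
  "h_W G W g f A B =
     card {D \<in> odd_components G f A B. \<forall>v \<in> verts D - W. g v = f v}"

definition delta ::
  "('a, 'b) pre_digraph \<Rightarrow> 'a set \<Rightarrow> ('a \<Rightarrow> int) \<Rightarrow> ('a \<Rightarrow> int) \<Rightarrow> 'a set \<Rightarrow> 'a set \<Rightarrow> int" where
  "delta G W g f A B =
     (\<Sum>v \<in> A. f v) - (\<Sum>v \<in> B. g v)
     + (\<Sum>v \<in> B. int (out_degree (G \<restriction> (verts G - A)) v)) - int (h_W G W g f A B)"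

definition barrier ::
  "('a, 'b) pre_digraph \<Rightarrow> 'a set \<Rightarrow> ('a \<Rightarrow> int) \<Rightarrow> ('a \<Rightarrow> int) \<Rightarrow> 'a set \<Rightarrow> 'a set \<Rightarrow> bool" where
  "barrier G W g f A B \<longleftrightarrow>
     A \<subseteq> verts G \<and> B \<subseteq> verts G \<and> A \<inter> B = {} \<and> delta G W g f A B < 0"

definition biased_barrier ::
  "('a, 'b) pre_digraph \<Rightarrow> 'a set \<Rightarrow> ('a \<Rightarrow> int) \<Rightarrow> ('a \<Rightarrow> int) \<Rightarrow> 'a set \<Rightarrow> 'a set \<Rightarrow> bool" where
  "biased_barrier G W g f A B \<longleftrightarrow> barrier G W g f A B \<and>
     (\<forall>A' B'. barrier G W g f A' B' \<longrightarrow>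
        delta G W g f A B \<le> delta G W g f A' B' \<and>
        (delta G W g f A' B' = delta G W g f A B \<longrightarrow>
           card B \<le> card B' \<and> (card B' = card B \<longrightarrow> card A' \<le> card A)))"

definition h_set ::
  "('a, 'b) pre_digraph \<Rightarrow> ('a \<Rightarrow> int) \<Rightarrow> 'a set \<Rightarrow> 'a set \<Rightarrow> 'a set \<Rightarrow> nat" where
  "h_set G f A B Z = card (nbhd G Z \<inter> B)
     + card {D \<in> odd_components G f A B. edges_between G Z (verts D) \<ge> 1}"

end

theory Submission
  imports Defs
begin

text \<open>
  A biased barrier minimises \<open>delta\<close> among all disjoint pairs, and no single modification of it may
  preserve \<open>delta\<close> while shrinking \<open>B\<close>, or while enlarging \<open>A\<close> with \<open>B\<close> fixed. Each part of the
  theorem tests one modification: removing a vertex of \<open>X\<close> from \<open>B\<close>, moving a vertex of a component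
  to \<open>A\<close>, and removing \<open>Z\<close> from \<open>A\<close>. In each case only odd components adjacent to (or containing)
  the moved vertices can stop being odd components. For the second modification this only bounds the
  increase of \<open>delta\<close> by \<open>1\<close>; since \<open>delta\<close> has the parity of the sum of \<open>f\<close> over the graph, which
  is even, there is in fact no increase.
\<close>

section \<open>Counting edges between vertex sets\<close>

context graph
begin

text \<open>Without parallel arcs an arc is determined by its ends, so arcs can be counted as
  ordered pairs. In this form, reversing all arcs is a swap of coordinates.\<close>

lemma edges_between_conv_pairs:
  "edges_between G S T = card {(u, v). u \<in> S \<and> v \<in> T \<and> u \<rightarrow>\<^bsub>G\<^esub> v}"
proof -
  let ?E = "{e \<in> arcs G. tail G e \<in> S \<and> head G e \<in> T}"
  have "inj_on (arc_to_ends G) ?E"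
  proof (rule inj_onI)
    fix e e' assume "e \<in> ?E" "e' \<in> ?E" "arc_to_ends G e = arc_to_ends G e'"
    then show "e = e'" by (intro no_multi_arcs) simp_all
  qed
  moreover have "arc_to_ends G ` ?E = {(u, v). u \<in> S \<and> v \<in> T \<and> u \<rightarrow>\<^bsub>G\<^esub> v}"
    unfolding arcs_ends_def by (auto simp: image_iff arc_to_ends_def)
  ultimately show ?thesis
    unfolding edges_between_def by (simp add: card_image[symmetric])
qed

lemma edges_between_commute: "edges_between G S T = edges_between G T S"
proof -
  have "(u, v) \<in> arcs_ends G \<longleftrightarrow> (v, u) \<in> arcs_ends G" for u v
    by (rule iffI; erule graph_symmetric)
  then have "{(u, v). u \<in> S \<and> v \<in> T \<and> u \<rightarrow>\<^bsub>G\<^esub> v} = {(u, v). u \<in> S \<and> v \<in> T \<and> v \<rightarrow>\<^bsub>G\<^esub> u}"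
    by blast
  also have "\<dots> = prod.swap ` {(u, v). u \<in> T \<and> v \<in> S \<and> u \<rightarrow>\<^bsub>G\<^esub> v}"
    by force
  finally show ?thesis
    by (simp add: edges_between_conv_pairs card_image)
qed

lemma edges_between_eq_0_iff:
  "edges_between G S T = 0 \<longleftrightarrow> (\<forall>u\<in>S. \<forall>v\<in>T. \<not> u \<rightarrow>\<^bsub>G\<^esub> v)"
proof -
  let ?E = "{e \<in> arcs G. tail G e \<in> S \<and> head G e \<in> T}"
  have "edges_between G S T = 0 \<longleftrightarrow> ?E = {}"
    unfolding edges_between_def by (rule card_0_eq) simp
  also have "\<dots> \<longleftrightarrow> (\<forall>e\<in>arcs G. \<not> (tail G e \<in> S \<and> head G e \<in> T))"
    by blast
  also have "\<dots> \<longleftrightarrow> (\<forall>u\<in>S. \<forall>v\<in>T. \<not> u \<rightarrow>\<^bsub>G\<^esub> v)"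
    unfolding arcs_ends_def arc_to_ends_def by blast
  finally show ?thesis .
qed

lemma edges_between_mono:
  "T \<subseteq> T' \<Longrightarrow> edges_between G S T \<le> edges_between G S T'"
  unfolding edges_between_def by (rule card_mono) auto

lemma edges_between_UN:
  assumes "finite I" and "\<And>i j. i \<in> I \<Longrightarrow> j \<in> I \<Longrightarrow> i \<noteq> j \<Longrightarrow> T i \<inter> T j = {}"
  shows "edges_between G S (\<Union>i\<in>I. T i) = (\<Sum>i\<in>I. edges_between G S (T i))"
proof -
  have "{e \<in> arcs G. tail G e \<in> S \<and> head G e \<in> (\<Union>i\<in>I. T i)} =
      (\<Union>i\<in>I. {e \<in> arcs G. tail G e \<in> S \<and> head G e \<in> T i})"
    by auto
  moreover have "card (\<Union>i\<in>I. {e \<in> arcs G. tail G e \<in> S \<and> head G e \<in> T i}) =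
      (\<Sum>i\<in>I. card {e \<in> arcs G. tail G e \<in> S \<and> head G e \<in> T i})"
    using assms by (intro card_UN_disjoint) auto
  ultimately show ?thesis
    by (simp add: edges_between_def)
qed

lemma edges_between_Un_right:
  assumes "T \<inter> T' = {}"
  shows "edges_between G S (T \<union> T') = edges_between G S T + edges_between G S T'"
proof -
  have "{e \<in> arcs G. tail G e \<in> S \<and> head G e \<in> T \<union> T'} =
      {e \<in> arcs G. tail G e \<in> S \<and> head G e \<in> T} \<union> {e \<in> arcs G. tail G e \<in> S \<and> head G e \<in> T'}"
    by auto
  then show ?thesis
    using assms unfolding edges_between_def by (simp add: card_Un_disjoint disjoint_iff)
qed

lemma edges_between_Un_left:
  assumes "S \<inter> S' = {}"
  shows "edges_between G (S \<union> S') T = edges_between G S T + edges_between G S' T"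
  using edges_between_Un_right[OF assms] by (simp add: edges_between_commute)

text \<open>There are no loops, and each edge inside \<open>S\<close> is counted twice, once per
  direction. In the induction, the arcs from the new vertex into \<open>S\<close> are matched by
  those coming back.\<close>

lemma even_edges_within:
  assumes "finite S"
  shows "even (edges_between G S S)"
  using assms
proof (induction S)
  case empty
  then show ?case by (simp add: edges_between_def)
next
  case (insert v S)
  have "edges_between G {v} {v} = 0"
    by (auto simp: edges_between_def dest: no_loops)
  moreover have "edges_between G ({v} \<union> S) ({v} \<union> S) =
      edges_between G {v} {v} + edges_between G {v} S
        + (edges_between G S {v} + edges_between G S S)"
    using edges_between_Un_left[of "{v}" S "{v} \<union> S"] insert.hyps
      edges_between_Un_right[of "{v}" S "{v}"] edges_between_Un_right[of "{v}" S S]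
    by simp
  moreover have "edges_between G S {v} = edges_between G {v} S"
    by (rule edges_between_commute)
  ultimately show ?case
    using insert.IH by simp
qed

lemma sum_out_degree_minus:
  assumes "B \<subseteq> verts G" and "A \<inter> B = {}"
  shows "(\<Sum>v\<in>B. out_degree (G \<restriction> (verts G - A)) v) = edges_between G B (verts G - A)"
proof -
  have "finite B"
    using assms by (auto intro: finite_subset)
  \<comment> \<open>The arcs are reversed because \<open>edges_between_UN\<close> splits the second
    argument; the singletons \<open>{v}\<close> then make up \<open>B\<close> there.\<close>
  have "out_degree (G \<restriction> (verts G - A)) v = edges_between G (verts G - A) {v}" if "v \<in> B" for v
  proof -
    have "out_arcs (G \<restriction> (verts G - A)) v = {e \<in> arcs G. tail G e \<in> {v} \<and> head G e \<in> verts G - A}"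
      using that assms by (auto simp: out_arcs_def)
    then have "out_degree (G \<restriction> (verts G - A)) v = edges_between G {v} (verts G - A)"
      by (simp add: out_degree_def edges_between_def)
    then show ?thesis
      by (simp add: edges_between_commute)
  qed
  then show ?thesis
    using edges_between_UN[OF \<open>finite B\<close>, of "\<lambda>v. {v}" "verts G - A"]
    by (simp add: edges_between_commute)
qed

section \<open>Components after deleting vertices\<close>

lemma graph_induce_subgraph: "graph (G \<restriction> (verts G - S))"
proof -
  have "induced_subgraph (G \<restriction> (verts G - S)) G" by auto
  then show ?thesis
    by (intro graph.intro pseudo_graph.intro digraphI_induced sym_digraph.intro sym_digraph_axioms.intro)
      (auto simp: pseudo_graph_def intro: digraph.axioms digraphI_induced wf_digraphI_induced induced_graph_imp_symmetric)
qed

lemma reachable_imp_in_closed: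
  assumes "u \<rightarrow>\<^sup>*\<^bsub>H\<^esub> w" and "u \<in> C" and "\<And>x y. x \<in> C \<Longrightarrow> x \<rightarrow>\<^bsub>H\<^esub> y \<Longrightarrow> y \<in> C"
  shows "w \<in> C"
  using assms(1) unfolding reachable_def
proof (induction rule: rtrancl_on_induct)
  case base
  show ?case by (rule assms(2))
next
  case (step y z)
  show ?case by (rule assms(3)[OF step.IH step.hyps(2)])
qed

text \<open>Adjacency is symmetric, so maximality of a strongly connected induced subgraph amounts
  to its vertex set being closed under adjacency outside \<open>S\<close>. This condition refers to
  \<open>G\<close> itself, which allows components for different deleted sets to be
  compared.\<close>

lemma components_minus_iff:
  "D \<in> components_minus G S \<longleftrightarrow>
     induced_subgraph D G \<and> strongly_connected D \<and> verts D \<subseteq> verts G - S \<and>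
     (\<forall>u\<in>verts D. \<forall>v\<in>verts G - S. u \<rightarrow>\<^bsub>G\<^esub> v \<longrightarrow> v \<in> verts D)" (is "?L \<longleftrightarrow> ?R")
proof -
  let ?H = "G \<restriction> (verts G - S)"
  interpret H: graph ?H by (rule graph_induce_subgraph)
  have ind: "induced_subgraph D ?H \<longleftrightarrow> induced_subgraph D G \<and> verts D \<subseteq> verts G - S" for D
    by (auto simp: induced_subgraph_def subgraph_def compatible_def H.wf_digraph wf_digraph)
  have adj: "u \<rightarrow>\<^bsub>?H\<^esub> v \<longleftrightarrow> u \<in> verts G - S \<and> v \<in> verts G - S \<and> u \<rightarrow>\<^bsub>G\<^esub> v" for u v
    by (force simp: arcs_ends_def arc_to_ends_def)
  show ?thesis
  proof
    assume ?L
    then have D: "D \<in> H.sccs" by (simp add: components_minus_def)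
    then have sub: "induced_subgraph D ?H" and sc: "strongly_connected D"
      by (auto simp: H.sccs_def)
    have "verts D \<in> H.sccs_verts"
      using D by (simp add: H.sccs_verts_conv)
    then have closed: "v \<in> verts D" if "u \<in> verts D" "u \<rightarrow>\<^bsub>?H\<^esub> v" for u v
      using that H.graph_symmetric[OF that(2)] unfolding H.in_sccs_verts_conv_reachable
      by (meson H.reachable_adjI)
    then show ?R
      using sub sc by (auto simp: ind adj)
  next
    assume R: ?R
    \<comment> \<open>A strictly larger strongly connected subgraph would contain a walk leaving the
      closed set \<open>verts D\<close>.\<close>
    have "D' \<notin> {D'. induced_subgraph D' ?H \<and> strongly_connected D' \<and> verts D \<subset> verts D'}" for D'
    proof
      assume "D' \<in> {D'. induced_subgraph D' ?H \<and> strongly_connected D' \<and> verts D \<subset> verts D'}"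
      then have D': "induced_subgraph D' ?H" "strongly_connected D'" "verts D \<subset> verts D'"
        by auto
      obtain u w where uw: "u \<in> verts D" "w \<in> verts D'" "w \<notin> verts D"
        using D'(3) R by (auto simp: strongly_connected_def)
      then have "u \<rightarrow>\<^sup>*\<^bsub>D'\<^esub> w"
        using D' by auto
      then have "u \<rightarrow>\<^sup>*\<^bsub>?H\<^esub> w"
        using D'(1) by (meson H.reachable_mono induced_imp_subgraph)
      then have "w \<in> verts D"
        using uw(1) by (rule reachable_imp_in_closed) (use R in \<open>auto simp: adj\<close>)
      with uw show False by simp
    qed
    then have "D \<in> H.sccs"
      using R by (intro H.in_sccsI) (auto simp: ind)
    then show ?L by (simp add: components_minus_def)
  qed
qed

lemma finite_components_minus: "finite (components_minus G S)"
  and components_minus_disjoint: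
    "D \<in> components_minus G S \<Longrightarrow> D' \<in> components_minus G S \<Longrightarrow> D \<noteq> D' \<Longrightarrow> verts D \<inter> verts D' = {}"
  and Union_components_minus: "(\<Union>D\<in>components_minus G S. verts D) = verts G - S"
proof -
  interpret H: graph "G \<restriction> (verts G - S)" by (rule graph_induce_subgraph)
  show "finite (components_minus G S)"
    using H.finite_sccs_verts H.inj_on_verts_sccs
    by (auto simp: components_minus_def H.sccs_verts_conv intro: finite_imageD)
  show "verts D \<inter> verts D' = {}"
    if "D \<in> components_minus G S" "D' \<in> components_minus G S" "D \<noteq> D'"
    using H.scc_disj that by (simp add: components_minus_def)
  have "(\<Union>D\<in>components_minus G S. verts D) = \<Union> H.sccs_verts"
    by (simp add: components_minus_def H.sccs_verts_conv)
  also have "\<dots> = verts G - S"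
    using H.sccs_verts_subsets H.scc_of_in_sccs_verts H.in_scc_of_self by fastforce
  finally show "(\<Union>D\<in>components_minus G S. verts D) = verts G - S" .
qed

lemma odd_components_subset: "odd_components G f A B \<subseteq> components_minus G (A \<union> B)"
  by (auto simp: odd_components_def)

lemma finite_odd_components: "finite (odd_components G f A B)"
  using odd_components_subset finite_components_minus by (rule finite_subset)

text \<open>Tool for all modifications of a barrier. If \<open>D\<close> meets no newly deleted
  vertex and has no edge to a vertex put back into the graph, it stays closed under adjacency and so
  stays a component; the last assumption keeps its parity.\<close>

lemma odd_components_transfer:
  assumes "D \<in> odd_components G f A B"
    and "verts D \<inter> (A' \<union> B') = {}"
    and "\<And>u w. u \<in> verts D \<Longrightarrow> w \<in> A \<union> B \<Longrightarrow> w \<notin> A' \<union> B' \<Longrightarrow> \<not> u \<rightarrow>\<^bsub>G\<^esub> w"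
    and "edges_between G (verts D) B' = edges_between G (verts D) B"
  shows "D \<in> odd_components G f A' B'"
proof -
  have "D \<in> components_minus G (A \<union> B)"
    using assms(1) by (simp add: odd_components_def)
  then have "D \<in> components_minus G (A' \<union> B')"
    using assms(2,3) unfolding components_minus_iff by blast
  then show ?thesis
    using assms(1,4) by (simp add: odd_components_def)
qed

text \<open>\<open>E\<close> collects the odd components that a modification may destroy. Any odd
  components that it creates only decrease \<open>delta\<close>, so a one-sided bound
  suffices.\<close>

lemma card_odd_components_le:
  assumes "odd_components G f A B - E \<subseteq> odd_components G f A' B'" and "finite E"
  shows "card (odd_components G f A B) \<le> card (odd_components G f A' B') + card E"
proof -
  have "card (odd_components G f A B) \<le> card (odd_components G f A' B' \<union> E)"
    using assms by (intro card_mono) (auto simp: finite_odd_components)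
  then show ?thesis
    using card_Un_le order_trans by blast
qed

section \<open>The value of \<open>delta\<close> and its parity\<close>

lemma delta_conv_edges_between:
  assumes "B \<subseteq> verts G" and "A \<inter> B = {}" and "\<forall>v\<in>verts G - W. g v = f v"
  shows "delta G W g f A B = (\<Sum>v\<in>A. f v) - (\<Sum>v\<in>B. g v)
    + int (edges_between G B (verts G - A)) - int (card (odd_components G f A B))"
proof -
  \<comment> \<open>As \<open>g\<close> and \<open>f\<close> agree on all vertices outside
    \<open>W\<close>, every odd component meets the condition in \<open>h_W\<close>.\<close>
  have "{D \<in> odd_components G f A B. \<forall>v\<in>verts D - W. g v = f v} = odd_components G f A B"
    using assms(3) odd_components_subset[of f A B] by (fastforce simp: components_minus_iff)
  then show ?thesis
    using sum_out_degree_minus[OF assms(1,2)]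
    by (simp add: delta_def h_W_def flip: of_nat_sum)
qed

text \<open>Modulo 2, the number of odd components is the sum over all components of the quantity
  defining their parity, that is, the sum of \<open>f\<close> over \<open>?U\<close> plus the number
  of edges between \<open>B\<close> and \<open>?U\<close>. The degree sum over \<open>B\<close> is
  congruent to the same number of edges, since edges inside \<open>B\<close> count twice. These
  cancel, and as \<open>g\<close> can be replaced by \<open>f\<close> on \<open>B\<close>, the sum
  of \<open>f\<close> over the whole graph remains.\<close>

lemma even_delta:
  assumes "A \<subseteq> verts G" and "B \<subseteq> verts G" and "A \<inter> B = {}"
    and gf: "\<forall>v\<in>verts G - W. g v = f v"
    and par: "\<And>v. v \<in> verts G \<Longrightarrow> even (f v - g v)"
    and ev: "even (\<Sum>v\<in>verts G. f v)"
  shows "even (delta G W g f A B)"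
proof -
  let ?U = "verts G - (A \<union> B)"
  let ?C = "components_minus G (A \<union> B)"
  let ?w = "\<lambda>D. (\<Sum>v\<in>verts D. f v) + int (edges_between G (verts D) B)"
  have fin: "finite A" "finite B"
    using assms by (auto intro: finite_subset)
  have "(\<Sum>D\<in>?C. \<Sum>v\<in>verts D. f v) = (\<Sum>v\<in>?U. f v)"
  proof -
    have "finite (verts D)" if "D \<in> ?C" for D
      using that by (auto simp: components_minus_iff intro: finite_subset)
    then have "(\<Sum>v\<in>(\<Union>D\<in>?C. verts D). f v) = (\<Sum>D\<in>?C. \<Sum>v\<in>verts D. f v)"
      by (intro sum.UNION_disjoint)
        (auto simp: finite_components_minus dest: components_minus_disjoint)
    then show ?thesis by (simp add: Union_components_minus)
  qed
  moreover have "(\<Sum>D\<in>?C. edges_between G (verts D) B) = edges_between G B ?U"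
    using edges_between_UN[of ?C verts B, OF finite_components_minus components_minus_disjoint]
    by (simp add: Union_components_minus edges_between_commute)
  ultimately have sum_w: "(\<Sum>D\<in>?C. ?w D) = (\<Sum>v\<in>?U. f v) + int (edges_between G B ?U)"
    by (simp add: sum.distrib flip: of_nat_sum)
  have "even (\<Sum>D\<in>?C. ?w D) \<longleftrightarrow> even (card (odd_components G f A B))"
    by (simp add: even_sum_iff finite_components_minus odd_components_def)
  moreover have "edges_between G B (verts G - A) = edges_between G B B + edges_between G B ?U"
  proof -
    have "verts G - A = B \<union> ?U" using assms by auto
    then show ?thesis using edges_between_Un_right[of B ?U B] by auto
  qed
  moreover have "(\<Sum>v\<in>verts G. f v) = (\<Sum>v\<in>A. f v) + (\<Sum>v\<in>B. f v) + (\<Sum>v\<in>?U. f v)"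
    using assms fin sum.subset_diff[of "A \<union> B" "verts G" f]
    by (simp add: sum.union_disjoint)
  moreover have "even ((\<Sum>v\<in>B. f v) - (\<Sum>v\<in>B. g v))"
    using par assms(2) by (auto simp: sum_subtractf[symmetric] intro!: dvd_sum)
  ultimately show ?thesis
    using ev sum_w even_edges_within[OF fin(2)] assms(2,3)
    by (simp add: delta_conv_edges_between[OF _ _ gf])
qed

end

section \<open>Extremality of a biased barrier among all disjoint pairs\<close>

lemma biased_barrier_minimum:
  assumes "biased_barrier G W g f A B"
    and "A' \<subseteq> verts G" and "B' \<subseteq> verts G" and "A' \<inter> B' = {}"
  shows "delta G W g f A B \<le> delta G W g f A' B'"
proof (cases "barrier G W g f A' B'")
  case True
  then show ?thesis using assms(1) by (simp add: biased_barrier_def)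
next
  case False
  \<comment> \<open>A disjoint pair that is not a barrier has nonnegative \<open>delta\<close>,
    while a barrier has negative \<open>delta\<close>.\<close>
  then show ?thesis using assms by (auto simp: biased_barrier_def barrier_def)
qed

text \<open>A disjoint pair whose \<open>delta\<close> is no larger is itself a barrier and attains
  the minimum, so the tie-breaking rules apply to it.\<close>

lemma biased_barrier_tie:
  assumes "biased_barrier G W g f A B"
    and "A' \<subseteq> verts G" and "B' \<subseteq> verts G" and "A' \<inter> B' = {}"
    and "delta G W g f A' B' \<le> delta G W g f A B"
  shows "card B \<le> card B'" and "card B' = card B \<Longrightarrow> card A' \<le> card A"
proof -
  have "barrier G W g f A' B'"
    using assms by (auto simp: biased_barrier_def barrier_def)
  moreover have "delta G W g f A' B' = delta G W g f A B"
    using biased_barrier_minimum[OF assms(1-4)] assms(5) by simp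
  ultimately show "card B \<le> card B'" and "card B' = card B \<Longrightarrow> card A' \<le> card A"
    using assms(1) by (auto simp: biased_barrier_def)
qed

section \<open>The three modifications of a biased barrier\<close>

context graph
begin

text \<open>Deleting \<open>v\<close> from \<open>B\<close> changes the \<open>g\<close> term of
  \<open>delta\<close> by \<open>g v\<close> and removes the arcs from \<open>v\<close> to
  \<open>verts G - A\<close>. At most that many odd components are lost, each being joined to
  \<open>v\<close> by an edge. If \<open>g v\<close> were at most 0, \<open>delta\<close> would not
  increase, against the minimality of \<open>card B\<close>.\<close>

lemma biased_barrier_g_pos:
  assumes bb: "biased_barrier G W g f A B"
    and gf: "\<forall>v\<in>verts G - W. g v = f v"
    and v: "v \<in> B"
  shows "0 < g v"
proof (rule ccontr)
  assume "\<not> 0 < g v"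
  have AB: "A \<subseteq> verts G" "B \<subseteq> verts G" "A \<inter> B = {}"
    using bb by (auto simp: biased_barrier_def barrier_def)
  then have fin: "finite B" by (auto intro: finite_subset)
  let ?E = "{D \<in> odd_components G f A B. edges_between G {v} (verts D) \<ge> 1}"
  have finE: "finite ?E" by (simp add: finite_odd_components)
  have comp: "D \<in> components_minus G (A \<union> B)" if "D \<in> odd_components G f A B" for D
    using that odd_components_subset by blast
  have "D \<in> odd_components G f A (B - {v})" if D: "D \<in> odd_components G f A B - ?E" for D
  proof (rule odd_components_transfer)
    show "D \<in> odd_components G f A B" using D by simp
    have "D \<in> components_minus G (A \<union> B)" using D comp by blast
    then show "verts D \<inter> (A \<union> (B - {v})) = {}"
      by (auto simp: components_minus_iff)
    have e0: "edges_between G (verts D) {v} = 0"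
      using D by (auto simp: edges_between_commute[of "verts D"])
    then show "\<not> u \<rightarrow>\<^bsub>G\<^esub> w" if "u \<in> verts D" "w \<in> A \<union> B" "w \<notin> A \<union> (B - {v})" for u w
      using that by (auto simp: edges_between_eq_0_iff)
    show "edges_between G (verts D) (B - {v}) = edges_between G (verts D) B"
      using edges_between_Un_right[of "B - {v}" "{v}" "verts D"] e0 v by (simp add: insert_absorb)
  qed
  then have "card (odd_components G f A B) \<le> card (odd_components G f A (B - {v})) + card ?E"
    using finE by (intro card_odd_components_le) auto
  \<comment> \<open>Distinct components are disjoint and each one in \<open>?E\<close> receives at
    least one arc from \<open>v\<close>.\<close>
  moreover have "card ?E \<le> edges_between G {v} (verts G - A)"
  proof -
    have "card ?E = (\<Sum>D\<in>?E. 1)" by simp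
    also have "\<dots> \<le> (\<Sum>D\<in>?E. edges_between G {v} (verts D))"
      by (rule sum_mono) auto
    also have "\<dots> = edges_between G {v} (\<Union>D\<in>?E. verts D)"
      using finE by (subst edges_between_UN) (auto dest!: comp dest: components_minus_disjoint)
    also have "\<dots> \<le> edges_between G {v} (verts G - A)"
      by (rule edges_between_mono) (auto dest!: comp simp: components_minus_iff)
    finally show ?thesis .
  qed
  moreover have "edges_between G B (verts G - A) =
      edges_between G {v} (verts G - A) + edges_between G (B - {v}) (verts G - A)"
    using edges_between_Un_left[of "{v}" "B - {v}" "verts G - A"] v by (simp add: insert_absorb)
  moreover have "(\<Sum>u\<in>B. g u) = g v + (\<Sum>u\<in>B - {v}. g u)"
    using fin v by (rule sum.remove)
  moreover have "B - {v} \<subseteq> verts G" "A \<inter> (B - {v}) = {}"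
    using AB by auto
  ultimately have "delta G W g f A (B - {v}) \<le> delta G W g f A B"
    using AB \<open>\<not> 0 < g v\<close> by (simp add: delta_conv_edges_between[OF _ _ gf])
  then have "card B \<le> card (B - {v})"
    using AB by (intro biased_barrier_tie(1)[OF bb]) auto
  moreover have "card (B - {v}) < card B"
    using fin v by (rule card_Diff1_less)
  ultimately show False by simp
qed

text \<open>Moving \<open>v\<close> into \<open>A\<close> adds \<open>f v\<close> to
  \<open>delta\<close>, subtracts the number of edges from \<open>v\<close> to \<open>B\<close>, and
  loses no odd component other than possibly \<open>D\<close>. If the bound failed,
  \<open>delta\<close> would grow by less than 2, hence by parity not at all, against the maximality
  of \<open>card A\<close>. For \<open>f v = 2\<close> the bound covers odd and even components at
  once.\<close>

lemma biased_barrier_component_vertex: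
  assumes bb: "biased_barrier G W g f A B"
    and gf: "\<forall>v\<in>verts G - W. g v = f v"
    and par: "\<And>v. v \<in> verts G \<Longrightarrow> even (f v - g v)"
    and ev: "even (\<Sum>v\<in>verts G. f v)"
    and D: "D \<in> components_minus G (A \<union> B)" and v: "v \<in> verts D"
  shows "int (edges_between G {v} B) + 2 \<le> f v + of_bool (D \<in> odd_components G f A B)"
proof (rule ccontr)
  assume neg: "\<not> ?thesis"
  have AB: "A \<subseteq> verts G" "B \<subseteq> verts G" "A \<inter> B = {}"
    using bb by (auto simp: biased_barrier_def barrier_def)
  then have fin: "finite A" by (auto intro: finite_subset)
  have vAB: "v \<in> verts G" "v \<notin> A" "v \<notin> B"
    using D v by (auto simp: components_minus_iff)
  let ?E = "{D} \<inter> odd_components G f A B"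
  \<comment> \<open>How \<open>D\<close> breaks up without \<open>v\<close> need not be known: odd
    pieces of it can only lower \<open>delta\<close>.\<close>
  have "D' \<in> odd_components G f (insert v A) B" if D': "D' \<in> odd_components G f A B - ?E" for D'
  proof (rule odd_components_transfer)
    have D'c: "D' \<in> components_minus G (A \<union> B)" "D' \<noteq> D"
      using D' odd_components_subset by auto
    then have "v \<notin> verts D'"
      using components_minus_disjoint D v by blast
    then show "verts D' \<inter> (insert v A \<union> B) = {}"
      using D'c by (auto simp: components_minus_iff)
  qed (use D' in auto)
  then have "card (odd_components G f A B) \<le> card (odd_components G f (insert v A) B) + card ?E"
    by (intro card_odd_components_le) auto
  moreover have "card ?E = of_bool (D \<in> odd_components G f A B)"
    by auto
  moreover have "edges_between G B (verts G - A) =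
      edges_between G {v} B + edges_between G B (verts G - insert v A)"
  proof -
    have "verts G - A = {v} \<union> (verts G - insert v A)"
      using vAB by auto
    then show ?thesis
      using edges_between_Un_right[of "{v}" "verts G - insert v A" B]
      by (simp add: edges_between_commute[of "{v}" B])
  qed
  moreover have vA: "insert v A \<subseteq> verts G" "insert v A \<inter> B = {}"
    using AB vAB by auto
  ultimately have "delta G W g f (insert v A) B < delta G W g f A B + 2"
    using AB vAB fin neg
    by (cases "D \<in> odd_components G f A B")
      (simp_all add: delta_conv_edges_between[OF _ _ gf])
  moreover have "even (delta G W g f (insert v A) B)" "even (delta G W g f A B)"
    using AB vA gf par ev by (auto intro!: even_delta)
  \<comment> \<open>Two even integers, the first less than the second plus 2.\<close>
  ultimately have "delta G W g f (insert v A) B \<le> delta G W g f A B"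
    by presburger
  then have "card (insert v A) \<le> card A"
    using AB vA by (intro biased_barrier_tie(2)[OF bb]) auto
  then show False
    using fin vAB by simp
qed

text \<open>Removing \<open>Z\<close> from \<open>A\<close> subtracts the sum of \<open>f\<close>
  over \<open>Z\<close> from \<open>delta\<close>. Since \<open>Z\<close> has no neighbour in
  \<open>B\<close>, the edge term is unchanged, and the odd components that may be lost, those
  adjacent to \<open>Z\<close>, number exactly \<open>h_set G f A B Z\<close>. Minimality of
  \<open>delta\<close> then bounds the sum.\<close>

lemma biased_barrier_sum_le_h_set:
  assumes bb: "biased_barrier G W g f A B"
    and gf: "\<forall>v\<in>verts G - W. g v = f v"
    and Z: "Z \<subseteq> A" and N: "nbhd G Z \<inter> B = {}"
  shows "(\<Sum>v\<in>Z. f v) \<le> int (h_set G f A B Z)"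
proof -
  have AB: "A \<subseteq> verts G" "B \<subseteq> verts G" "A \<inter> B = {}"
    using bb by (auto simp: biased_barrier_def barrier_def)
  then have fin: "finite A" by (auto intro: finite_subset)
  let ?E = "{D \<in> odd_components G f A B. edges_between G Z (verts D) \<ge> 1}"
  have "D \<in> odd_components G f (A - Z) B" if D: "D \<in> odd_components G f A B - ?E" for D
  proof (rule odd_components_transfer)
    have "D \<in> components_minus G (A \<union> B)"
      using D odd_components_subset by auto
    then show "verts D \<inter> (A - Z \<union> B) = {}"
      by (auto simp: components_minus_iff)
    have "edges_between G (verts D) Z = 0"
      using D by (auto simp: edges_between_commute[of "verts D"])
    then show "\<not> u \<rightarrow>\<^bsub>G\<^esub> w" if "u \<in> verts D" "w \<in> A \<union> B" "w \<notin> A - Z \<union> B" for u w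
      using that by (auto simp: edges_between_eq_0_iff)
  qed (use D in auto)
  then have "card (odd_components G f A B) \<le> card (odd_components G f (A - Z) B) + card ?E"
    by (intro card_odd_components_le) (auto simp: finite_odd_components)
  moreover have "card ?E = h_set G f A B Z"
    using N by (simp add: h_set_def)
  moreover have "edges_between G B (verts G - (A - Z)) = edges_between G B (verts G - A)"
  proof -
    have "edges_between G B Z = 0"
      using N AB unfolding edges_between_commute[of B Z] edges_between_eq_0_iff
      by (auto simp: nbhd_def)
    moreover have "verts G - (A - Z) = (verts G - A) \<union> Z"
      using Z AB by auto
    ultimately show ?thesis
      using edges_between_Un_right[of "verts G - A" Z B] Z by auto
  qed
  moreover have "(\<Sum>v\<in>A. f v) = (\<Sum>v\<in>A - Z. f v) + (\<Sum>v\<in>Z. f v)"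
    using Z fin by (rule sum.subset_diff)
  moreover have "A - Z \<subseteq> verts G" "(A - Z) \<inter> B = {}"
    using AB by auto
  moreover have "delta G W g f A B \<le> delta G W g f (A - Z) B"
    using AB by (intro biased_barrier_minimum[OF bb]) auto
  ultimately show ?thesis
    using AB by (simp add: delta_conv_edges_between[OF _ _ gf])
qed

end

section \<open>Specialisation to the bipartite graph\<close>

theorem theorem2p4:
  fixes G :: "('a, 'b) pre_digraph" and X Y A B :: "'a set"
    and f g :: "'a \<Rightarrow> int" and k :: nat
  assumes "graph G"
    and "bipartition G X Y"
    and "k \<ge> 1"
    and "even (k * card Y)"
    and "\<forall>v \<in> X. f v = 2 \<and> g v = 0"
    and "\<forall>v \<in> Y. f v = int k \<and> g v = int k"
    and "\<not> (\<exists>F. partial_parity_factor G X g f F)"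
    and "biased_barrier G X g f A B"
  shows "B \<subseteq> Y
    \<and> (\<forall>D \<in> odd_components G f A B. \<forall>v \<in> verts D. edges_between G {v} B \<le> 1)
    \<and> (\<forall>D \<in> even_components G f A B. \<forall>v \<in> verts D. edges_between G {v} B = 0)
    \<and> (\<forall>Z. Z \<subseteq> A \<inter> X \<and> nbhd G Z \<inter> B = {} \<longrightarrow> h_set G f A B Z \<ge> 2 * card Z)"
proof -
  interpret graph G by fact
  have XY: "verts G = X \<union> Y" "X \<inter> Y = {}"
    and bip: "\<And>e. e \<in> arcs G \<Longrightarrow>
      tail G e \<in> X \<and> head G e \<in> Y \<or> tail G e \<in> Y \<and> head G e \<in> X"
    using assms(2) by (auto simp: bipartition_def)
  have fin: "finite X" "finite Y"
    using finite_verts XY by (metis finite_Un)+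
  have gf: "\<forall>v\<in>verts G - X. g v = f v"
    using XY assms(6) by auto
  have par: "even (f v - g v)" if "v \<in> verts G" for v
    using that XY assms(5,6) by auto
  have "(\<Sum>v\<in>verts G. f v) = 2 * int (card X) + int (k * card Y)"
    using assms(5,6) fin XY by (simp add: sum.union_disjoint)
  then have ev: "even (\<Sum>v\<in>verts G. f v)"
    using assms(4) by simp
  \<comment> \<open>Vertices of \<open>X\<close> have \<open>g\<close> equal to 0, so the positivity
    of \<open>g\<close> on \<open>B\<close> excludes them.\<close>
  have B: "B \<subseteq> Y"
  proof
    fix v assume "v \<in> B"
    then have "0 < g v" "v \<in> verts G"
      using biased_barrier_g_pos[OF assms(8) gf] assms(8)
      by (auto simp: biased_barrier_def barrier_def)
    then show "v \<in> Y" using XY assms(5) by auto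
  qed
  have zero: "edges_between G {v} B = 0" if "v \<in> Y" for v
    using that B XY bip by (fastforce simp: edges_between_def)
  \<comment> \<open>Parts (ii) and (iii) together: a vertex of \<open>Y\<close> has no neighbour in
    \<open>B\<close>, as \<open>B\<close> lies in \<open>Y\<close>, and for a vertex of
    \<open>X\<close> the value \<open>f v = 2\<close> cancels the 2 in the general bound.\<close>
  have vertex: "edges_between G {v} B \<le> of_bool (D \<in> odd_components G f A B)"
    if D: "D \<in> components_minus G (A \<union> B)" "v \<in> verts D" for D v
  proof (cases "v \<in> Y")
    case True
    then show ?thesis by (simp add: zero)
  next
    case False
    then have "f v = 2"
      using that XY assms(5) by (auto simp: components_minus_iff)
    then show ?thesis
      using biased_barrier_component_vertex[OF assms(8) gf par ev D]
      by (cases "D \<in> odd_components G f A B") auto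
  qed
  have "2 * card Z \<le> h_set G f A B Z" if Z: "Z \<subseteq> A \<inter> X" "nbhd G Z \<inter> B = {}" for Z
  proof -
    have "(\<Sum>v\<in>Z. f v) = (\<Sum>v\<in>Z. 2)"
      using Z assms(5) by (intro sum.cong) auto
    then show ?thesis
      using biased_barrier_sum_le_h_set[OF assms(8) gf _ Z(2)] Z(1) by simp
  qed
  moreover have "edges_between G {v} B \<le> 1" if "D \<in> odd_components G f A B" "v \<in> verts D" for D v
    using vertex[of D v] that by (simp add: odd_components_def)
  moreover have "edges_between G {v} B = 0" if "D \<in> even_components G f A B" "v \<in> verts D" for D v
    using vertex[of D v] that by (simp add: even_components_def)
  ultimately show ?thesis
    using B by blast
qed

end
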